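(* Let $K\subset\mathbb{R}^2$ be a connected compact body and let $\mu$ be a probability measure on $(K,\mathcal{B}(K))$ such that $\mu(B(p,\varepsilon)\cap K)>0$ for all $p\in K$ and $\varepsilon>0$, and such that $\mu(\{(\alpha,\beta)\in K:\alpha=x\})=0=\mu(\{(\alpha,\beta)\in K:\beta=y\})$ for all $x,y\in\mathbb{R}$. Let $(t_k)_{k\in\mathbb{N}}$ be a decreasing sequence of positive numbers with $\sum_{k=1}^\infty t_k=\infty$ and $\sum_{k=1}^\infty t_k^2<\infty$, let $x_0\in K$ be arbitrary, and let $(X_k)_{k\ge 0}$ be the sequence of $\mathbb{R}^2$-valued random variables defined by the recursion $X_0=x_0$, $X_{k+1}=X_k-t_{k+1}Q_{k+1}$ described in the context. Then the sequence of real random variables $(F_{K,\mu}(X_k))_{k\in\mathbb{N}}$ converges almost surely and in $L^q$, for every $q\in\mathbb{N}$, to $F_{K,\mu}(X^* )$ as $k\to\infty$, where $X^*$ denotes the unique global minimizer of the generalized conic function $F_{K,\mu}$.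
   Context: A compact body in $\mathbb{R}^2$ is a non-empty compact set that coincides with the closure of its interior. $\mathbb{N}$ denotes the positive integers, $\mathcal{B}(K)$ is the Borel $\sigma$-algebra on $K$, and $B(p,\varepsilon)$ is the open Euclidean ball around $p$ with radius $\varepsilon$. The generalized conic function associated with $K$ and a finite measure $\mu$ on $(K,\mathcal{B}(K))$ is $F_{K,\mu}:\mathbb{R}^2\to\mathbb{R}$, $$F_{K,\mu}(x,y):=\int_K\big(|x-\alpha|+|y-\beta|\big)\,\mu(d\alpha,d\beta).$$ The recursion: let $(P_k)_{k\in\mathbb{N}}$, $P_k=(P_k^{(1)},P_k^{(2)})$, be a sequence of independent identically distributed $\mathbb{R}^2$-valued random variables with common distribution $\mu$ (regarded as a probability measure on $\mathbb{R}^2$ concentrated on $K$). Set $X_0:=x_0$ and, for $k\ge 0$, with $X_k=(X_k^{(1)},X_k^{(2)})$, $X_{k+1}:=X_k-t_{k+1}Q_{k+1}$, where $Q_{k+1}=(Q_{k+1}^{(1)},Q_{k+1}^{(2)})^\top$ with, for $j=1,2$, $Q_{k+1}^{(j)}=1$ if $X_k^{(j)}\ge P_{k+1}^{(j)}$ and $Q_{k+1}^{(j)}=-1$ if $X_k^{(j)}<P_{k+1}^{(j)}$. *)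

theory Defs
  imports "HOL-Probability.Probability"
begin

definition compact_body :: "(real \<times> real) set \<Rightarrow> bool" where
  "compact_body K \<longleftrightarrow> K \<noteq> {} \<and> compact K \<and> K = closure (interior K)"

definition generalized_conic ::
    "(real \<times> real) set \<Rightarrow> (real \<times> real) measure \<Rightarrow> real \<times> real \<Rightarrow> real" where
  "generalized_conic K \<mu> z = (LINT p:K|\<mu>. \<bar>fst z - fst p\<bar> + \<bar>snd z - snd p\<bar>)"

text \<open>One coordinate of the direction vector \<open>Q\<close>; unlike \<^const>\<open>sgn\<close>, ties count as \<open>+1\<close>.\<close>

definition step_sign :: "real \<Rightarrow> real \<Rightarrow> real" where
  "step_sign x p = (if x \<ge> p then 1 else -1)"

text \<open>The step sizes \<open>t\<close> and the samples \<open>P\<close> are indexed by the positive integers: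
  \<open>t 0\<close> and \<open>P 0\<close> are never used.\<close>

primrec stoch_iter ::
    "(nat \<Rightarrow> real) \<Rightarrow> (nat \<Rightarrow> 'w \<Rightarrow> real \<times> real) \<Rightarrow> real \<times> real \<Rightarrow> nat \<Rightarrow> 'w \<Rightarrow> real \<times> real" where
  "stoch_iter t P x0 0 \<omega> = x0"
| "stoch_iter t P x0 (Suc k) \<omega> = stoch_iter t P x0 k \<omega> - t (Suc k) *\<^sub>R
     (step_sign (fst (stoch_iter t P x0 k \<omega>)) (fst (P (Suc k) \<omega>)),
      step_sign (snd (stoch_iter t P x0 k \<omega>)) (snd (P (Suc k) \<omega>)))"

text \<open>Membership in \<open>L\<^sup>q\<close> is required explicitly, because the Bochner integral of a
  non-integrable function is \<open>0\<close>.\<close>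

definition converges_in_Lq ::
    "'w measure \<Rightarrow> nat \<Rightarrow> (nat \<Rightarrow> 'w \<Rightarrow> real) \<Rightarrow> ('w \<Rightarrow> real) \<Rightarrow> bool" where
  "converges_in_Lq M q Y Z \<longleftrightarrow>
     (\<forall>k. Y k \<in> borel_measurable M \<and> integrable M (\<lambda>\<omega>. \<bar>Y k \<omega>\<bar> ^ q)) \<and>
     Z \<in> borel_measurable M \<and> integrable M (\<lambda>\<omega>. \<bar>Z \<omega>\<bar> ^ q) \<and>
     (\<lambda>k. \<integral>\<omega>. \<bar>Y k \<omega> - Z \<omega>\<bar> ^ q \<partial>M) \<longlonglongrightarrow> 0"

end

theory Submission
  imports Defs
begin

text \<open>
  Everything splits along the two coordinates. The conic function is the sum of
  \<open>f\<^sub>1 (fst z)\<close> and \<open>f\<^sub>2 (snd z)\<close>, where \<open>f\<^sub>j\<close> is the mean absolute deviation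
  (\<open>abs_dev\<close>) from the \<open>j\<close>-th marginal \<open>\<nu>\<close> of \<open>\<mu>\<close>, and each coordinate of \<open>X\<close> follows
  its own scalar recursion \<open>x' = x - t s\<close>, driven by independent samples of \<open>\<nu>\<close>. The
  step direction \<open>s = step_sign x p\<close> has mean \<open>2 G x - 1\<close>, with \<open>G\<close> the distribution
  function of \<open>\<nu>\<close>, and this number is a subgradient of \<open>f\<^sub>j\<close> at \<open>x\<close>: the recursion is
  stochastic subgradient descent.

  The projection of \<open>K\<close> is a compact interval, \<open>\<nu>\<close> charges every ball centred in it and has
  no atoms. So \<open>G\<close> is continuous, and strictly increasing wherever it lies strictly between
  0 and 1 (\<open>cdf_strict\<close>); it takes the value 1/2 at exactly one point, the median \<open>m\<close>.
  The subgradient vanishes at \<open>m\<close> and points strictly away from \<open>m\<close> elsewhere, whence \<open>m\<close>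
  is the unique minimizer of \<open>f\<^sub>j\<close> (\<open>abs_dev_median_less\<close>).

  For the convergence \<open>x k \<rightarrow> m\<close> consider the energy
  \<open>W k = (x k - m)\<^sup>2 + (\<Sum>i>k. (t i)\<^sup>2)\<close>. Every step has length exactly \<open>t (k + 1)\<close>, so
  the tail of the series absorbs the quadratic term and
  \<open>W (k + 1) = W k - 2 t (k + 1) (x k - m) s\<close>. Averaging over the new sample, also on an
  event \<open>A\<close> that depends only on the first \<open>k\<close> samples, gives
  \<open>E (1\<^sub>A W (k + 1)) = E (1\<^sub>A W k) - 2 t (k + 1) E (1\<^sub>A drift (x k))\<close> with
  \<open>drift y = (y - m) (2 G y - 1) \<ge> 0\<close> (\<open>expectation_energy_Suc\<close>). This identity serves
  twice. With \<open>A\<close> the whole space it forces \<open>E (W k) \<rightarrow> 0\<close>: a multiple of the drift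
  dominates the squared distance up to an arbitrarily small error, and the \<open>t k\<close> have infinite sum
  (\<open>drift_tendsto_0\<close>). With \<open>A\<close> the event that \<open>W\<close> has stayed below a level \<open>c\<close>
  it yields the maximal inequality \<open>c P (\<exists>k\<ge>n. W k \<ge> c) \<le> E (W n)\<close>. The right side
  tends to 0 with \<open>n\<close>, so \<open>W k \<rightarrow> 0\<close> almost surely, without any appeal to a martingale
  convergence theorem.

  Finally \<open>f\<^sub>j\<close> is Lipschitz, which carries the almost sure convergence over to the conic
  function. The iterates almost surely never leave a fixed bounded interval, so convergence
  in \<open>L\<^sup>q\<close> is dominated convergence.
\<close>

section \<open>A maximal inequality and almost sure convergence\<close>

text \<open>Ville's inequality for nonnegative supermartingales. The supermartingale property is
  asked for only on the events that the process has stayed below \<open>c\<close> from time \<open>n\<close> on, which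
  spares a filtration and conditional expectations. Writing \<open>A k\<close> for that event at time
  \<open>k\<close>, the quantity \<open>E (W k; A k) + c P (- A k)\<close>, the mean of the process frozen at height
  \<open>c\<close> when it leaves \<open>A\<close>, does not increase: on \<open>A k - A (Suc k)\<close> the number \<open>c\<close> is at
  most \<open>W (Suc k)\<close>.\<close>

lemma (in prob_space) maximal_inequality:
  fixes W :: "nat \<Rightarrow> 'a \<Rightarrow> real"
  assumes int: "\<And>k. integrable M (W k)"
    and nonneg: "\<And>k \<omega>. W k \<omega> \<ge> 0"
    and dec: "\<And>k. n \<le> k \<Longrightarrow>
      (\<integral>\<omega>. indicator {\<omega> \<in> space M. \<forall>j\<in>{n..k}. W j \<omega> < c} \<omega> * W (Suc k) \<omega> \<partial>M)
      \<le> (\<integral>\<omega>. indicator {\<omega> \<in> space M. \<forall>j\<in>{n..k}. W j \<omega> < c} \<omega> * W k \<omega> \<partial>M)"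
  shows "c * prob {\<omega> \<in> space M. \<exists>k\<ge>n. W k \<omega> \<ge> c} \<le> expectation (W n)"
proof -
  have [measurable]: "W k \<in> borel_measurable M" for k
    using int by blast
  define A where "A k = {\<omega> \<in> space M. \<forall>j\<in>{n..k}. W j \<omega> < c}" for k
  have [measurable]: "A k \<in> sets M" for k
    unfolding A_def by measurable
  have intA: "integrable M (\<lambda>\<omega>. indicator (A j) \<omega> * W k \<omega>)" for j k
    using integrable_mult_indicator[OF \<open>A j \<in> sets M\<close> int[of k]] by simp
  have bound: "expectation (\<lambda>\<omega>. indicator (A k) \<omega> * W k \<omega>) + c * prob (space M - A k)
      \<le> expectation (W n)" if "n \<le> k" for k
    using that
  proof (induction k rule: dec_induct)
    case base
    have intI: "integrable M (\<lambda>\<omega>. c * indicator (space M - A n) \<omega>)"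
      by (intro integrable_mult_right integrable_real_indicator)
        (auto simp: emeasure_eq_measure)
    have "c * prob (space M - A n) = expectation (\<lambda>\<omega>. c * indicator (space M - A n) \<omega>)"
      by simp
    moreover have "expectation (\<lambda>\<omega>. indicator (A n) \<omega> * W n \<omega>)
        + expectation (\<lambda>\<omega>. c * indicator (space M - A n) \<omega>)
      = expectation (\<lambda>\<omega>. indicator (A n) \<omega> * W n \<omega> + c * indicator (space M - A n) \<omega>)"
      by (intro Bochner_Integration.integral_add[symmetric] intA intI)
    moreover have "\<dots> \<le> expectation (W n)"
      by (intro integral_mono Bochner_Integration.integrable_add intA intI int)
        (auto simp: A_def indicator_def)
    ultimately show ?case by linarith
  next
    case (step k)
    have eq: "space M - A (Suc k) = (space M - A k) \<union> (A k - A (Suc k))"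
      using step by (auto simp: A_def)
    have split: "prob (space M - A (Suc k)) = prob (space M - A k) + prob (A k - A (Suc k))"
      unfolding eq by (rule finite_measure_Union) auto
    have intI: "integrable M (\<lambda>\<omega>. c * indicator (A k - A (Suc k)) \<omega>)"
      by (intro integrable_mult_right integrable_real_indicator)
        (auto simp: emeasure_eq_measure)
    from split have "expectation (\<lambda>\<omega>. indicator (A (Suc k)) \<omega> * W (Suc k) \<omega>)
          + c * prob (space M - A (Suc k))
        = (expectation (\<lambda>\<omega>. indicator (A (Suc k)) \<omega> * W (Suc k) \<omega>)
          + expectation (\<lambda>\<omega>. c * indicator (A k - A (Suc k)) \<omega>)) + c * prob (space M - A k)"
      by (simp add: algebra_simps)
    also have "expectation (\<lambda>\<omega>. indicator (A (Suc k)) \<omega> * W (Suc k) \<omega>)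
          + expectation (\<lambda>\<omega>. c * indicator (A k - A (Suc k)) \<omega>)
        = expectation (\<lambda>\<omega>. indicator (A (Suc k)) \<omega> * W (Suc k) \<omega>
            + c * indicator (A k - A (Suc k)) \<omega>)"
      by (intro Bochner_Integration.integral_add[symmetric] intA intI)
    also have "\<dots> \<le> expectation (\<lambda>\<omega>. indicator (A k) \<omega> * W (Suc k) \<omega>)"
      using step
      by (intro integral_mono Bochner_Integration.integrable_add intA intI)
        (auto simp: A_def indicator_def le_Suc_eq)
    also have "\<dots> \<le> expectation (\<lambda>\<omega>. indicator (A k) \<omega> * W k \<omega>)"
      using dec[of k] step unfolding A_def by simp
    finally show ?case
      using step.IH by simp
  qed
  have "(\<lambda>k. prob (space M - A (n + k))) \<longlonglongrightarrow> prob (\<Union>k. space M - A (n + k))"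
    by (intro finite_Lim_measure_incseq) (auto simp: incseq_def A_def)
  then have "(\<lambda>k. c * prob (space M - A (n + k))) \<longlonglongrightarrow> c * prob (\<Union>k. space M - A (n + k))"
    by (rule tendsto_mult_left)
  moreover have "c * prob (space M - A (n + k)) \<le> expectation (W n)" for k
  proof -
    have "0 \<le> expectation (\<lambda>\<omega>. indicator (A (n + k)) \<omega> * W (n + k) \<omega>)"
      by (intro Bochner_Integration.integral_nonneg) (auto simp: nonneg)
    then show ?thesis
      using bound[of "n + k"] by simp
  qed
  ultimately have "c * prob (\<Union>k. space M - A (n + k)) \<le> expectation (W n)"
    by (intro LIMSEQ_le_const2) auto
  moreover have "(\<Union>k. space M - A (n + k)) = {\<omega> \<in> space M. \<exists>k\<ge>n. W k \<omega> \<ge> c}"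
  proof (intro equalityI subsetI)
    fix \<omega> assume "\<omega> \<in> {\<omega> \<in> space M. \<exists>k\<ge>n. W k \<omega> \<ge> c}"
    then obtain k where "\<omega> \<in> space M" "n \<le> k" "W k \<omega> \<ge> c" by auto
    then have "\<omega> \<in> space M - A (n + (k - n))"
      by (auto simp: A_def not_less)
    then show "\<omega> \<in> (\<Union>k. space M - A (n + k))" by blast
  qed (auto simp: A_def not_less)
  ultimately show ?thesis by simp
qed

text \<open>The event that \<open>W k \<ge> c\<close> infinitely often lies inside each event \<open>\<exists>k\<ge>n. W k \<ge> c\<close>, so
  its probability is at most \<open>e n / c\<close> for every \<open>n\<close>.\<close>

lemma (in prob_space) AE_tendsto_0_of_maximal:
  fixes W :: "nat \<Rightarrow> 'a \<Rightarrow> real"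
  assumes meas: "\<And>k. W k \<in> borel_measurable M"
    and nonneg: "\<And>k \<omega>. W k \<omega> \<ge> 0"
    and max: "\<And>n c. c > 0 \<Longrightarrow> c * prob {\<omega> \<in> space M. \<exists>k\<ge>n. W k \<omega> \<ge> c} \<le> e n"
    and e: "e \<longlonglongrightarrow> 0"
  shows "AE \<omega> in M. (\<lambda>k. W k \<omega>) \<longlonglongrightarrow> 0"
proof -
  note [measurable] = meas
  have ev: "AE \<omega> in M. eventually (\<lambda>k. W k \<omega> < c) sequentially" if c: "c > 0" for c
  proof -
    define N where "N = {\<omega> \<in> space M. \<forall>n. \<exists>k\<ge>n. W k \<omega> \<ge> c}"
    have [measurable]: "N \<in> sets M" unfolding N_def by measurable
    have "c * prob N \<le> e n" for n
    proof -
      have "prob N \<le> prob {\<omega> \<in> space M. \<exists>k\<ge>n. W k \<omega> \<ge> c}"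
        by (intro finite_measure_mono) (auto simp: N_def)
      then have "c * prob N \<le> c * prob {\<omega> \<in> space M. \<exists>k\<ge>n. W k \<omega> \<ge> c}"
        using c by simp
      also have "\<dots> \<le> e n" by (rule max[OF c])
      finally show ?thesis .
    qed
    then have "c * prob N \<le> 0"
      using e by (intro LIMSEQ_le_const) auto
    then have "prob N = 0"
      using c measure_nonneg[of M N] by (simp add: mult_le_0_iff)
    then have "AE \<omega> in M. \<omega> \<notin> N"
      using AE_iff_measurable[of N M "\<lambda>\<omega>. \<omega> \<notin> N"] sets.sets_into_space[of N M]
      by (auto simp: emeasure_eq_measure)
    moreover have "AE \<omega> in M. \<omega> \<in> space M" by simp
    ultimately show ?thesis
      by eventually_elim (force simp: N_def eventually_sequentially simp flip: not_le)
  qed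
  have "AE \<omega> in M. \<forall>i::nat. eventually (\<lambda>k. W k \<omega> < inverse (real (Suc i))) sequentially"
    unfolding AE_all_countable using ev by simp
  then show ?thesis
  proof eventually_elim
    case (elim \<omega>)
    show ?case
    proof (rule tendstoI)
      fix \<epsilon> :: real assume "\<epsilon> > 0"
      then obtain i where "inverse (real (Suc i)) < \<epsilon>"
        using reals_Archimedean by blast
      with elim[rule_format, of i] show "eventually (\<lambda>k. dist (W k \<omega>) 0 < \<epsilon>) sequentially"
        by (auto elim!: eventually_mono simp: nonneg)
    qed
  qed
qed

section \<open>Sequences pushed down by a drift\<close>

text \<open>If \<open>e\<close> stayed above some \<open>\<epsilon>\<close>, then \<open>d\<close> would eventually stay above some \<open>\<kappa>\<close>, and \<open>e\<close>
  would lose at least \<open>\<kappa> t n\<close> in the \<open>n\<close>-th step, in total an infinite amount. Since \<open>e\<close>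
  is decreasing, falling below \<open>\<epsilon>\<close> once is enough.\<close>

lemma drift_tendsto_0:
  fixes e d t :: "nat \<Rightarrow> real"
  assumes e: "\<And>n. e n \<ge> 0" and d: "\<And>n. d n \<ge> 0" and t: "\<And>n. t (Suc n) \<ge> 0"
    and dec: "\<And>n. e (Suc n) \<le> e n - t (Suc n) * d n"
    and div: "filterlim (\<lambda>n. \<Sum>k=1..n. t k) at_top sequentially"
    and low: "\<And>\<epsilon>. \<epsilon> > 0 \<Longrightarrow> \<exists>\<kappa>>0. eventually (\<lambda>n. e n \<ge> \<epsilon> \<longrightarrow> d n \<ge> \<kappa>) sequentially"
  shows "e \<longlonglongrightarrow> 0"
proof -
  have anti: "decseq e"
  proof (rule decseq_SucI)
    fix n
    have "t (Suc n) * d n \<ge> 0" using t d by simp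
    then show "e (Suc n) \<le> e n" using dec[of n] by linarith
  qed
  show ?thesis
  proof (rule LIMSEQ_I)
    fix \<epsilon> :: real assume \<epsilon>: "\<epsilon> > 0"
    have "\<exists>N. e N < \<epsilon>"
    proof (rule ccontr)
      assume "\<nexists>N. e N < \<epsilon>"
      then have big: "e n \<ge> \<epsilon>" for n by (meson not_less)
      obtain \<kappa> N where \<kappa>: "\<kappa> > 0" and N: "\<And>n. n \<ge> N \<Longrightarrow> d n \<ge> \<kappa>"
        using low[OF \<epsilon>] big by (auto simp: eventually_sequentially)
      have bd: "\<kappa> * (\<Sum>k=1..n. t k) \<le> e N + \<kappa> * (\<Sum>k=1..N. t k) - e n" if "n \<ge> N" for n
        using that
      proof (induction n rule: dec_induct)
        case (step n)
        have "t (Suc n) * \<kappa> \<le> t (Suc n) * d n"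
          using N[of n] t step by (intro mult_left_mono) auto
        then show ?case using step.IH dec[of n] by (simp add: algebra_simps)
      qed simp
      have "eventually (\<lambda>n. (\<Sum>k=1..n. t k) > (e N + \<kappa> * (\<Sum>k=1..N. t k)) / \<kappa>) sequentially"
        using div by (simp add: filterlim_at_top_dense)
      then obtain n where "n \<ge> N" "(\<Sum>k=1..n. t k) > (e N + \<kappa> * (\<Sum>k=1..N. t k)) / \<kappa>"
        unfolding eventually_sequentially by (meson nat_le_linear order.refl)
      then have "\<kappa> * (\<Sum>k=1..n. t k) > e N + \<kappa> * (\<Sum>k=1..N. t k)"
        using \<kappa> by (simp add: divide_less_eq mult.commute)
      then show False using bd[OF \<open>n \<ge> N\<close>] e[of n] by linarith
    qed
    then obtain N where "e N < \<epsilon>" by blast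
    then show "\<exists>N. \<forall>n\<ge>N. norm (e n - 0) < \<epsilon>"
      using e decseqD[OF anti] by (intro exI[of _ N]) (fastforce simp: abs_of_nonneg)
  qed
qed

section \<open>The mean step direction\<close>

lemma integral_step_sign:
  assumes "prob_space \<nu>" "sets \<nu> = sets borel"
  shows "(\<integral>y. step_sign x y \<partial>\<nu>) = 2 * cdf \<nu> x - 1"
proof -
  interpret prob_space \<nu> by fact
  have "(\<integral>y. step_sign x y \<partial>\<nu>) = (\<integral>y. 2 * indicator {..x} y - 1 \<partial>\<nu>)"
    by (intro Bochner_Integration.integral_cong) (auto simp: step_sign_def)
  also have "\<dots> = 2 * measure \<nu> {..x} - 1"
    using assms(2) prob_space sets_eq_imp_space_eq[OF assms(2)]
    by (subst Bochner_Integration.integral_diff) (auto simp: emeasure_eq_measure)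
  finally show ?thesis by (simp add: cdf_def)
qed

lemma abs_step_sign [simp]: "\<bar>step_sign x y\<bar> = 1"
  by (simp add: step_sign_def)

lemma step_sign_measurable [measurable (raw)]:
  assumes [measurable]: "f \<in> borel_measurable N" "g \<in> borel_measurable N"
  shows "(\<lambda>u. step_sign (f u) (g u)) \<in> borel_measurable N"
  unfolding step_sign_def by measurable

text \<open>Fubini's theorem for the joint law of the independent variables \<open>U\<close> (the past) and \<open>V\<close>
  (the new sample): integrating the new sample out first replaces the direction by its mean.
  The new sample enters as \<open>\<eta> (V \<omega>)\<close> because independence is stated for two variables
  with values in the same type, here functions on sets of indices.\<close>

lemma (in prob_space) expectation_step_sign_indep:
  assumes indep: "indep_var N U L V"
    and g [measurable]: "g \<in> borel_measurable N" and \<xi> [measurable]: "\<xi> \<in> borel_measurable N"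
    and \<eta> [measurable]: "\<eta> \<in> borel_measurable L"
    and int: "integrable M (\<lambda>\<omega>. g (U \<omega>))"
  shows "expectation (\<lambda>\<omega>. g (U \<omega>) * step_sign (\<xi> (U \<omega>)) (\<eta> (V \<omega>)))
    = expectation (\<lambda>\<omega>. g (U \<omega>) * (2 * cdf (distr M borel (\<lambda>\<omega>. \<eta> (V \<omega>))) (\<xi> (U \<omega>)) - 1))"
proof -
  note [measurable] = indep_var_rv1[OF indep] indep_var_rv2[OF indep]
  let ?D = "distr M N U" and ?E = "distr M L V" and ?\<nu> = "distr M borel (\<lambda>\<omega>. \<eta> (V \<omega>))"
  let ?f = "\<lambda>(u, v). g u * step_sign (\<xi> u) (\<eta> v)"
  have joint: "?D \<Otimes>\<^sub>M ?E = distr M (N \<Otimes>\<^sub>M L) (\<lambda>\<omega>. (U \<omega>, V \<omega>))"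
    using indep indep_var_distribution_eq by blast
  have "integrable M (\<lambda>\<omega>. ?f (U \<omega>, V \<omega>))"
    by (rule Bochner_Integration.integrable_bound[OF int]) (auto simp: abs_mult)
  then have f_int: "integrable (?D \<Otimes>\<^sub>M ?E) ?f"
    unfolding joint by (subst integrable_distr_eq) auto
  have inner: "(\<integral>v. step_sign y (\<eta> v) \<partial>?E) = 2 * cdf ?\<nu> y - 1" for y
  proof -
    have "(\<integral>v. step_sign y (\<eta> v) \<partial>?E) = (\<integral>z. step_sign y z \<partial>?\<nu>)"
      by (subst (1 2) integral_distr) auto
    also have "\<dots> = 2 * cdf ?\<nu> y - 1"
      by (intro integral_step_sign prob_space_distr) auto
    finally show ?thesis .
  qed
  interpret D: prob_space ?D by (intro prob_space_distr) measurable
  interpret E: prob_space ?E by (intro prob_space_distr) measurable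
  interpret DE: pair_prob_space ?D ?E ..
  have [measurable]: "cdf ?\<nu> \<in> borel_measurable borel"
  proof -
    interpret \<nu>: real_distribution ?\<nu>
      by (auto simp: real_distribution_def real_distribution_axioms_def intro!: prob_space_distr)
    show ?thesis
      by (rule borel_measurable_mono) (auto intro!: monoI \<nu>.cdf_nondecreasing)
  qed
  have "expectation (\<lambda>\<omega>. ?f (U \<omega>, V \<omega>)) = integral\<^sup>L (?D \<Otimes>\<^sub>M ?E) ?f"
    unfolding joint by (subst integral_distr) auto
  also have "\<dots> = (\<integral>u. (\<integral>v. ?f (u, v) \<partial>?E) \<partial>?D)"
    by (rule DE.integral_fst'[OF f_int, symmetric])
  also have "\<dots> = (\<integral>u. g u * (2 * cdf ?\<nu> (\<xi> u) - 1) \<partial>?D)"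
    by (simp add: inner)
  also have "\<dots> = expectation (\<lambda>\<omega>. g (U \<omega>) * (2 * cdf ?\<nu> (\<xi> (U \<omega>)) - 1))"
    by (subst integral_distr) auto
  finally show ?thesis by simp
qed

section \<open>The scalar recursion converges to the median\<close>

text \<open>The samples are a parameter of the form \<open>nat \<Rightarrow> 'w \<Rightarrow> real\<close>, so that \<open>'w\<close> can also be
  the space of sample sequences, with the coordinate projections \<open>\<lambda>i u. u i\<close> as samples.
  In this way \<open>sign_iter\<close> itself expresses an iterate as a function of the past.\<close>

primrec sign_iter ::
    "(nat \<Rightarrow> real) \<Rightarrow> (nat \<Rightarrow> 'w \<Rightarrow> real) \<Rightarrow> real \<Rightarrow> nat \<Rightarrow> 'w \<Rightarrow> real" where
  "sign_iter t p x0 0 \<omega> = x0"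
| "sign_iter t p x0 (Suc k) \<omega> =
     sign_iter t p x0 k \<omega> - t (Suc k) * step_sign (sign_iter t p x0 k \<omega>) (p (Suc k) \<omega>)"

lemma fst_stoch_iter:
  "fst (stoch_iter t P x0 k \<omega>) = sign_iter t (\<lambda>i \<omega>. fst (P i \<omega>)) (fst x0) k \<omega>"
  by (induction k) simp_all

lemma snd_stoch_iter:
  "snd (stoch_iter t P x0 k \<omega>) = sign_iter t (\<lambda>i \<omega>. snd (P i \<omega>)) (snd x0) k \<omega>"
  by (induction k) simp_all

lemma sign_iter_measurable:
  assumes "\<And>i. 1 \<le> i \<Longrightarrow> i \<le> k \<Longrightarrow> p i \<in> borel_measurable N"
  shows "sign_iter t p x0 k \<in> borel_measurable N"
  using assms
proof (induction k)
  case 0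
  have "sign_iter t p x0 0 = (\<lambda>_. x0)" by (simp add: fun_eq_iff)
  then show ?case by simp
next
  case (Suc k)
  have [measurable]: "sign_iter t p x0 k \<in> borel_measurable N" "p (Suc k) \<in> borel_measurable N"
    using Suc by auto
  have "sign_iter t p x0 (Suc k) = (\<lambda>\<omega>. sign_iter t p x0 k \<omega>
      - t (Suc k) * step_sign (sign_iter t p x0 k \<omega>) (p (Suc k) \<omega>))"
    by (simp add: fun_eq_iff)
  also have "\<dots> \<in> borel_measurable N" by measurable
  finally show ?case .
qed

lemma sign_iter_restrict:
  assumes "k \<le> n"
  shows "sign_iter t (\<lambda>i u. u i) x0 k (restrict (\<lambda>i. p i \<omega>) {1..n}) = sign_iter t p x0 k \<omega>"
  using assms by (induction k) auto

text \<open>To the right of \<open>b\<close> every sample sends the iterate to the left, and to the left of \<open>a\<close> to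
  the right; so \<open>{a..b}\<close> is overshot by at most one step.\<close>

lemma sign_iter_bounds:
  assumes "\<And>i. i \<ge> 1 \<Longrightarrow> p i \<omega> \<in> {a..b}" "x0 \<in> {a..b}" "\<And>i. i \<ge> 1 \<Longrightarrow> t i \<in> {0..T}"
  shows "sign_iter t p x0 k \<omega> \<in> {a - T..b + T}"
proof (induction k)
  case 0
  show ?case using assms(2) assms(3)[of 1] by auto
next
  case (Suc k)
  show ?case
    using Suc assms(1)[of "Suc k"] assms(3)[of "Suc k"] by (auto simp: step_sign_def)
qed

text \<open>The scalar recursion for a bounded sample distribution \<open>\<nu>\<close> whose distribution function
  crosses the level 1/2 at a single point \<open>m\<close>.\<close>

locale median_recursion = prob_space M for M :: "'w measure" +
  fixes \<nu> :: "real measure" and t :: "nat \<Rightarrow> real" and p :: "nat \<Rightarrow> 'w \<Rightarrow> real"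
    and x0 m a b :: real
  assumes indep: "indep_vars (\<lambda>_. borel) p {1..}"
    and distr_p: "\<And>k. k \<ge> 1 \<Longrightarrow> distr M borel (p k) = \<nu>"
    and below_median: "\<And>x. x < m \<Longrightarrow> cdf \<nu> x < 1/2"
    and above_median: "\<And>x. x > m \<Longrightarrow> cdf \<nu> x > 1/2"
    and bounded: "AE y in \<nu>. y \<in> {a..b}"
    and x0_bounds: "x0 \<in> {a..b}"
    and t_pos: "\<And>k. k \<ge> 1 \<Longrightarrow> t k > 0"
    and t_dec: "\<And>k. k \<ge> 1 \<Longrightarrow> t (Suc k) \<le> t k"
    and t_div: "filterlim (\<lambda>n. \<Sum>k=1..n. t k) at_top sequentially"
    and t_sq: "summable (\<lambda>k. (t (Suc k))\<^sup>2)"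
begin

abbreviation x :: "nat \<Rightarrow> 'w \<Rightarrow> real" where "x \<equiv> sign_iter t p x0"

text \<open>The mean of \<open>(y - m) * step_sign y p\<close> over a sample \<open>p\<close>, that is, half the mean rate,
  to first order in the step length, at which a step from \<open>y\<close> reduces \<open>(y - m)\<^sup>2\<close>.\<close>

definition drift :: "real \<Rightarrow> real" where "drift y = (y - m) * (2 * cdf \<nu> y - 1)"

definition tail :: "nat \<Rightarrow> real" where "tail k = (\<Sum>i. (t (Suc (i + k)))\<^sup>2)"

text \<open>Adding the squares of the future steps compensates the quadratic terms that they contribute
  to the squared distance.\<close>

definition energy :: "nat \<Rightarrow> 'w \<Rightarrow> real" where "energy k \<omega> = (x k \<omega> - m)\<^sup>2 + tail k"

definition radius :: real where "radius = \<bar>a\<bar> + \<bar>b\<bar> + \<bar>m\<bar> + t 1"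

abbreviation past :: "nat \<Rightarrow> 'w \<Rightarrow> nat \<Rightarrow> real" where
  "past k \<omega> \<equiv> restrict (\<lambda>i. p i \<omega>) {1..k}"

abbreviation Past :: "nat \<Rightarrow> (nat \<Rightarrow> real) measure" where
  "Past k \<equiv> PiM {1..k} (\<lambda>_. borel)"

lemma p_measurable: "k \<ge> 1 \<Longrightarrow> p k \<in> borel_measurable M"
  using indep by (auto simp: indep_vars_def)

lemma x_measurable [measurable]: "x k \<in> borel_measurable M"
  by (rule sign_iter_measurable) (rule p_measurable)

lemma sets_\<nu> [measurable_cong]: "sets \<nu> = sets borel"
  using distr_p[of 1] by (metis order_refl sets_distr)

sublocale nu: real_distribution \<nu>
proof -
  have "prob_space (distr M borel (p 1))"
    by (rule prob_space_distr) (rule p_measurable, simp)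
  then show "real_distribution \<nu>"
    using distr_p[of 1] sets_\<nu> sets_eq_imp_space_eq[OF sets_\<nu>]
    by (auto simp: real_distribution_def real_distribution_axioms_def)
qed

lemma cdf_measurable [measurable]: "cdf \<nu> \<in> borel_measurable borel"
  by (rule borel_measurable_mono) (auto intro!: monoI nu.cdf_nondecreasing)

lemma t_le: "k \<ge> 1 \<Longrightarrow> t k \<in> {0..t 1}"
proof (induction k rule: dec_induct)
  case base
  show ?case using t_pos[of 1] by simp
next
  case (step k)
  then show ?case using t_pos[of "Suc k"] t_dec[of k] by simp
qed

lemma x_bounded: "AE \<omega> in M. \<forall>k. \<bar>x k \<omega> - m\<bar> \<le> radius"
proof -
  have "AE \<omega> in M. p k \<omega> \<in> {a..b}" if "k \<ge> 1" for k
    using bounded p_measurable[OF that]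
    by (subst (asm) distr_p[OF that, symmetric], subst (asm) AE_distr_iff) auto
  then have "AE \<omega> in M. \<forall>k. k \<ge> 1 \<longrightarrow> p k \<omega> \<in> {a..b}"
    by (subst AE_all_countable) auto
  then show ?thesis
  proof eventually_elim
    case (elim \<omega>)
    have "x k \<omega> \<in> {a - t 1..b + t 1}" for k
      using elim x0_bounds t_le by (intro sign_iter_bounds) auto
    then have "a - t 1 \<le> x k \<omega> \<and> x k \<omega> \<le> b + t 1" for k
      by simp
    then show ?case
      unfolding radius_def by (smt (verit))
  qed
qed

lemma integrable_of_bounded:
  assumes [measurable]: "f \<in> borel_measurable borel"
    and f: "\<And>y. \<bar>y - m\<bar> \<le> radius \<Longrightarrow> \<bar>f y\<bar> \<le> (C::real)"
  shows "integrable M (\<lambda>\<omega>. f (x k \<omega>))"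
  using x_bounded by (intro integrable_const_bound[where B=C]) (auto elim!: eventually_mono simp: f)

lemma drift_measurable [measurable]: "drift \<in> borel_measurable borel"
  unfolding drift_def by measurable

lemma abs_drift_le: "\<bar>drift y\<bar> \<le> \<bar>y - m\<bar>"
  using nu.cdf_bounded_prob[of y] nu.cdf_nonneg[of y]
  unfolding drift_def abs_mult by (intro mult_left_le) auto

text \<open>Both factors change sign at \<open>m\<close>.\<close>

lemma drift_nonneg: "drift y \<ge> 0"
  using below_median[of y] above_median[of y]
  by (cases y m rule: linorder_cases)
    (auto simp: drift_def intro!: mult_nonneg_nonneg mult_nonpos_nonpos)

lemma drift_integrable: "integrable M (\<lambda>\<omega>. drift (x k \<omega>))"
  by (rule integrable_of_bounded[where C=radius]) (simp, rule order_trans[OF abs_drift_le])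

lemma square_integrable: "integrable M (\<lambda>\<omega>. (x k \<omega> - m)\<^sup>2)"
proof (rule integrable_of_bounded[where C="radius\<^sup>2"])
  fix y assume "\<bar>y - m\<bar> \<le> radius"
  then have "\<bar>y - m\<bar>\<^sup>2 \<le> radius\<^sup>2" by (intro power_mono) auto
  then show "\<bar>(y - m)\<^sup>2\<bar> \<le> radius\<^sup>2" by simp
qed simp

lemma energy_integrable: "integrable M (energy k)"
  unfolding energy_def using square_integrable by auto

lemma tail_nonneg: "tail k \<ge> 0"
  unfolding tail_def using t_sq by (intro suminf_nonneg) (auto simp: summable_iff_shift[where f="\<lambda>k. (t (Suc k))\<^sup>2"])

lemma tail_Suc: "tail k = (t (Suc k))\<^sup>2 + tail (Suc k)"
proof -
  have "summable (\<lambda>i. (t (Suc (i + k)))\<^sup>2)"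
    using t_sq by (subst summable_iff_shift[where f="\<lambda>k. (t (Suc k))\<^sup>2"])
  from suminf_split_head[OF this] show ?thesis
    by (simp add: tail_def)
qed

lemma tail_tendsto_0: "tail \<longlonglongrightarrow> 0"
  unfolding tail_def[abs_def] using suminf_exist_split2[OF t_sq] .

lemma energy_nonneg: "energy k \<omega> \<ge> 0"
  using tail_nonneg by (simp add: energy_def)

text \<open>The direction squares to 1, so the quadratic term is exactly the difference of two
  consecutive tails.\<close>

lemma energy_Suc:
  "energy (Suc k) \<omega> = energy k \<omega>
     - 2 * t (Suc k) * ((x k \<omega> - m) * step_sign (x k \<omega>) (p (Suc k) \<omega>))"
proof -
  define s where "s = step_sign (x k \<omega>) (p (Suc k) \<omega>)"
  have "s\<^sup>2 = 1" by (simp add: s_def step_sign_def)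
  then show ?thesis
    unfolding energy_def tail_Suc[of k] sign_iter.simps s_def[symmetric]
    by (simp add: algebra_simps power2_eq_square)
qed

lemma indep_past: "indep_var (Past k) (past k) (PiM {Suc k} (\<lambda>_. borel)) (\<lambda>\<omega>. restrict (\<lambda>i. p i \<omega>) {Suc k})"
  by (rule indep_var_restrict[OF indep]) auto

text \<open>The supermartingale identity: the event \<open>S\<close> and the iterate \<open>x k\<close> are functions of the
  past, and the new sample is independent of it.\<close>

lemma expectation_energy_Suc:
  assumes S: "S \<in> sets (Past k)"
  shows "expectation (\<lambda>\<omega>. indicator S (past k \<omega>) * energy (Suc k) \<omega>)
    = expectation (\<lambda>\<omega>. indicator S (past k \<omega>) * energy k \<omega>)
      - 2 * t (Suc k) * expectation (\<lambda>\<omega>. indicator S (past k \<omega>) * drift (x k \<omega>))"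
proof -
  note [measurable] = S indep_var_rv1[OF indep_past]
  have [measurable]: "p (Suc k) \<in> borel_measurable M" by (rule p_measurable) simp
  \<comment> \<open>the iterate as a function on the space of pasts\<close>
  define \<xi> where "\<xi> = sign_iter t (\<lambda>i u. u i) x0 k"
  have \<xi>_past: "\<xi> (past k \<omega>) = x k \<omega>" for \<omega>
    unfolding \<xi>_def by (rule sign_iter_restrict) simp
  have \<xi> [measurable]: "\<xi> \<in> borel_measurable (Past k)"
    unfolding \<xi>_def by (rule sign_iter_measurable) (auto intro!: measurable_component_singleton)
  have ind: "integrable M (\<lambda>\<omega>. indicator S (past k \<omega>) * f \<omega>)" if "integrable M f" for f :: "'w \<Rightarrow> real"
  proof (rule Bochner_Integration.integrable_bound[OF that])
    have [measurable]: "f \<in> borel_measurable M" using that by simp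
    show "(\<lambda>\<omega>. indicator S (past k \<omega>) * f \<omega>) \<in> borel_measurable M" by measurable
  qed (auto simp: indicator_def)
  have lin: "integrable M (\<lambda>\<omega>. x k \<omega> - m)"
    by (rule integrable_of_bounded[where C=radius]) auto
  let ?g = "\<lambda>u. indicator S u * (\<xi> u - m)"
  have g_int: "integrable M (\<lambda>\<omega>. ?g (past k \<omega>))"
    unfolding \<xi>_past by (rule ind[OF lin])
  have "expectation (\<lambda>\<omega>. ?g (past k \<omega>) *
        step_sign (\<xi> (past k \<omega>)) ((\<lambda>u. u (Suc k)) (restrict (\<lambda>i. p i \<omega>) {Suc k})))
      = expectation (\<lambda>\<omega>. ?g (past k \<omega>) *
        (2 * cdf (distr M borel (\<lambda>\<omega>. (\<lambda>u. u (Suc k)) (restrict (\<lambda>i. p i \<omega>) {Suc k}))) (\<xi> (past k \<omega>)) - 1))"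
  proof (rule expectation_step_sign_indep[OF indep_past, where g = ?g and \<xi> = \<xi> and \<eta> = "\<lambda>u. u (Suc k)"])
    show "?g \<in> borel_measurable (Past k)"
      by (intro borel_measurable_times borel_measurable_indicator S borel_measurable_diff \<xi> borel_measurable_const)
    show "(\<lambda>u. u (Suc k)) \<in> borel_measurable (PiM {Suc k} (\<lambda>_. borel))"
      by (rule measurable_component_singleton) simp
  qed (rule \<xi> g_int)+
  then have key: "expectation (\<lambda>\<omega>. indicator S (past k \<omega>) * (x k \<omega> - m) * step_sign (x k \<omega>) (p (Suc k) \<omega>))
      = expectation (\<lambda>\<omega>. indicator S (past k \<omega>) * drift (x k \<omega>))"
    using distr_p[of "Suc k"] by (simp add: \<xi>_past drift_def mult.assoc del: One_nat_def)
  have int2: "integrable M (\<lambda>\<omega>. indicator S (past k \<omega>) * (x k \<omega> - m) * step_sign (x k \<omega>) (p (Suc k) \<omega>))"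
    by (rule Bochner_Integration.integrable_bound[OF ind[OF lin]], measurable) (simp add: abs_mult)
  have "expectation (\<lambda>\<omega>. indicator S (past k \<omega>) * energy (Suc k) \<omega>)
      = expectation (\<lambda>\<omega>. indicator S (past k \<omega>) * energy k \<omega> - 2 * t (Suc k) *
          (indicator S (past k \<omega>) * (x k \<omega> - m) * step_sign (x k \<omega>) (p (Suc k) \<omega>)))"
    by (intro Bochner_Integration.integral_cong) (auto simp: energy_Suc algebra_simps)
  also have "\<dots> = expectation (\<lambda>\<omega>. indicator S (past k \<omega>) * energy k \<omega>)
      - 2 * t (Suc k) * expectation (\<lambda>\<omega>. indicator S (past k \<omega>) * (x k \<omega> - m) * step_sign (x k \<omega>) (p (Suc k) \<omega>))"
    by (subst Bochner_Integration.integral_diff[OF ind[OF energy_integrable] integrable_mult_right[OF int2]])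
      simp
  finally show ?thesis unfolding key .
qed

lemma energy_maximal:
  "c * prob {\<omega> \<in> space M. \<exists>k\<ge>n. energy k \<omega> \<ge> c} \<le> expectation (energy n)"
proof (rule maximal_inequality)
  fix k assume "n \<le> k"
  define S where "S = {u \<in> space (Past k). \<forall>j\<in>{n..k}. (sign_iter t (\<lambda>i u. u i) x0 j u - m)\<^sup>2 + tail j < c}"
  have "sign_iter t (\<lambda>i u. u i) x0 j \<in> borel_measurable (Past k)" if "j \<in> {n..k}" for j
    using that by (intro sign_iter_measurable) (auto intro!: measurable_component_singleton)
  note [measurable] = this
  have S: "S \<in> sets (Past k)"
    unfolding S_def by measurable
  have "past k \<omega> \<in> S \<longleftrightarrow> \<omega> \<in> {\<omega> \<in> space M. \<forall>j\<in>{n..k}. energy j \<omega> < c}" if "\<omega> \<in> space M" for \<omega>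
  proof -
    have "past k \<omega> \<in> space (Past k)"
      by (auto simp: space_PiM)
    then show ?thesis
      using that by (simp add: S_def energy_def sign_iter_restrict del: One_nat_def)
  qed
  then have eq: "expectation (\<lambda>\<omega>. indicator {\<omega> \<in> space M. \<forall>j\<in>{n..k}. energy j \<omega> < c} \<omega> * f \<omega>)
      = expectation (\<lambda>\<omega>. indicator S (past k \<omega>) * f \<omega>)" for f :: "'w \<Rightarrow> real"
    by (intro Bochner_Integration.integral_cong) (auto simp: indicator_def)
  have "0 \<le> expectation (\<lambda>\<omega>. indicator S (past k \<omega>) * drift (x k \<omega>))"
    by (intro Bochner_Integration.integral_nonneg) (simp add: drift_nonneg)
  then have "0 \<le> 2 * t (Suc k) * expectation (\<lambda>\<omega>. indicator S (past k \<omega>) * drift (x k \<omega>))"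
    using t_pos[of "Suc k"] by simp
  then show "expectation (\<lambda>\<omega>. indicator {\<omega> \<in> space M. \<forall>j\<in>{n..k}. energy j \<omega> < c} \<omega> * energy (Suc k) \<omega>)
      \<le> expectation (\<lambda>\<omega>. indicator {\<omega> \<in> space M. \<forall>j\<in>{n..k}. energy j \<omega> < c} \<omega> * energy k \<omega>)"
    unfolding eq expectation_energy_Suc[OF S] by linarith
qed (simp_all add: energy_integrable energy_nonneg)

text \<open>Outside the \<open>\<delta>\<close>-neighbourhood of \<open>m\<close> the factor \<open>2 G y - 1\<close> of the drift is, in
  absolute value, bounded away from 0 by monotonicity of \<open>G = cdf \<nu>\<close>. So a multiple of the
  drift dominates \<open>\<bar>y - m\<bar>\<close>, and hence on a bounded set also \<open>(y - m)\<^sup>2\<close>.\<close>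

lemma square_le_drift:
  assumes "\<delta> > 0"
  obtains C where "C > 0" "\<And>y. \<bar>y - m\<bar> \<le> radius \<Longrightarrow> (y - m)\<^sup>2 \<le> \<delta>\<^sup>2 + C * drift y"
proof
  define c where "c = min (2 * cdf \<nu> (m + \<delta>) - 1) (1 - 2 * cdf \<nu> (m - \<delta>))"
  have c: "c > 0"
    using above_median[of "m + \<delta>"] below_median[of "m - \<delta>"] assms by (simp add: c_def)
  have r: "radius > 0" using t_pos[of 1] by (simp add: radius_def)
  show "radius / c > 0" using c r by simp
  fix y assume y: "\<bar>y - m\<bar> \<le> radius"
  show "(y - m)\<^sup>2 \<le> \<delta>\<^sup>2 + radius / c * drift y"
  proof (cases "\<bar>y - m\<bar> \<le> \<delta>")
    case True
    then have "(y - m)\<^sup>2 \<le> \<delta>\<^sup>2" using assms by (simp add: abs_le_square_iff[symmetric])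
    moreover have "radius / c * drift y \<ge> 0" using c r drift_nonneg by simp
    ultimately show ?thesis by linarith
  next
    case False
    have low: "\<bar>y - m\<bar> * c \<le> drift y"
    proof (cases "y \<ge> m")
      case True
      then have "cdf \<nu> (m + \<delta>) \<le> cdf \<nu> y" using False by (intro nu.cdf_nondecreasing) auto
      then show ?thesis using True unfolding drift_def by (auto intro!: mult_left_mono simp: c_def)
    next
      case F: False
      then have "cdf \<nu> y \<le> cdf \<nu> (m - \<delta>)" using False by (intro nu.cdf_nondecreasing) auto
      then have "(m - y) * c \<le> (m - y) * (1 - 2 * cdf \<nu> y)"
        using F by (intro mult_left_mono) (auto simp: c_def)
      then show ?thesis using F unfolding drift_def by (auto simp: algebra_simps)
    qed
    have "(y - m)\<^sup>2 \<le> radius * \<bar>y - m\<bar>"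
      using y mult_right_mono[of "\<bar>y - m\<bar>" "radius" "\<bar>y - m\<bar>"] by (simp add: power2_eq_square)
    also have "\<dots> = radius / c * (\<bar>y - m\<bar> * c)" using c by simp
    also have "\<dots> \<le> radius / c * drift y"
      using low c r by (intro mult_left_mono) auto
    finally show ?thesis by (simp add: add_increasing)
  qed
qed

text \<open>If the mean energy is at least \<open>\<epsilon>\<close>, then a part \<open>\<epsilon> / 4\<close> may come from the error term of
  \<open>square_le_drift\<close>, another \<open>\<epsilon> / 4\<close> from the tail of the series, and the remaining \<open>\<epsilon> / 2\<close>
  from the drift, which is therefore bounded below.\<close>

lemma expectation_energy_tendsto_0: "(\<lambda>k. expectation (energy k)) \<longlonglongrightarrow> 0"
proof (rule drift_tendsto_0[where t = t and d = "\<lambda>k. 2 * expectation (\<lambda>\<omega>. drift (x k \<omega>))"])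
  show "expectation (energy k) \<ge> 0" for k
    by (intro Bochner_Integration.integral_nonneg energy_nonneg)
  show "2 * expectation (\<lambda>\<omega>. drift (x k \<omega>)) \<ge> 0" for k
    by (simp add: drift_nonneg)
  show "t (Suc k) \<ge> 0" for k
    using t_pos[of "Suc k"] by simp
  \<comment> \<open>the supermartingale identity on the whole space\<close>
  show "expectation (energy (Suc k)) \<le> expectation (energy k) - t (Suc k) * (2 * expectation (\<lambda>\<omega>. drift (x k \<omega>)))" for k
  proof -
    have top: "indicator (space (Past k)) (past k \<omega>) = (1::real)" for \<omega>
      by (simp add: space_PiM indicator_def)
    show ?thesis
      using expectation_energy_Suc[OF sets.top, of k] unfolding top by simp
  qed
  show "filterlim (\<lambda>n. \<Sum>k=1..n. t k) at_top sequentially" by (rule t_div)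
  fix \<epsilon> :: real assume \<epsilon>: "\<epsilon> > 0"
  obtain C where C: "C > 0" "\<And>y. \<bar>y - m\<bar> \<le> radius \<Longrightarrow> (y - m)\<^sup>2 \<le> (sqrt (\<epsilon> / 4))\<^sup>2 + C * drift y"
    using square_le_drift[of "sqrt (\<epsilon> / 4)"] \<epsilon> by auto
  have le: "expectation (energy k) \<le> \<epsilon> / 4 + C * expectation (\<lambda>\<omega>. drift (x k \<omega>)) + tail k" for k
  proof -
    have "expectation (\<lambda>\<omega>. (x k \<omega> - m)\<^sup>2) \<le> expectation (\<lambda>\<omega>. \<epsilon> / 4 + C * drift (x k \<omega>))"
      using x_bounded C(2) \<epsilon>
      by (intro integral_mono_AE square_integrable Bochner_Integration.integrable_add
          integrable_mult_right drift_integrable) (auto elim!: eventually_mono)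
    also have "\<dots> = \<epsilon> / 4 + C * expectation (\<lambda>\<omega>. drift (x k \<omega>))"
      by (subst Bochner_Integration.integral_add) (auto simp: drift_integrable prob_space)
    finally show ?thesis
      unfolding energy_def
      by (subst Bochner_Integration.integral_add) (auto simp: square_integrable prob_space)
  qed
  have "eventually (\<lambda>k. tail k < \<epsilon> / 4) sequentially"
    using order_tendstoD(2)[OF tail_tendsto_0, of "\<epsilon> / 4"] \<epsilon> by simp
  then have "eventually (\<lambda>k. \<epsilon> \<le> expectation (energy k) \<longrightarrow> \<epsilon> / C \<le> 2 * expectation (\<lambda>\<omega>. drift (x k \<omega>))) sequentially"
  proof eventually_elim
    case (elim k)
    show ?case
      using elim le[of k] C(1) by (auto simp: field_simps)
  qed
  then show "\<exists>\<kappa>>0. eventually (\<lambda>k. \<epsilon> \<le> expectation (energy k) \<longrightarrow> \<kappa> \<le> 2 * expectation (\<lambda>\<omega>. drift (x k \<omega>))) sequentially"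
    using \<epsilon> C(1) by (intro exI[of _ "\<epsilon> / C"]) auto
qed

lemma AE_tendsto_median: "AE \<omega> in M. (\<lambda>k. x k \<omega>) \<longlonglongrightarrow> m"
proof -
  have "AE \<omega> in M. (\<lambda>k. energy k \<omega>) \<longlonglongrightarrow> 0"
    using energy_integrable energy_nonneg energy_maximal expectation_energy_tendsto_0
    by (intro AE_tendsto_0_of_maximal[where e="\<lambda>k. expectation (energy k)"]) auto
  then show ?thesis
  proof eventually_elim
    case (elim \<omega>)
    have "(\<lambda>k. (x k \<omega> - m)\<^sup>2) \<longlonglongrightarrow> 0"
      using tendsto_diff[OF elim tail_tendsto_0] by (simp add: energy_def)
    then have "(\<lambda>k. sqrt ((x k \<omega> - m)\<^sup>2)) \<longlonglongrightarrow> 0"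
      using tendsto_real_sqrt by fastforce
    then show ?case
      by (simp add: tendsto_rabs_zero_iff LIM_zero_iff)
  qed
qed

end

section \<open>The median of a distribution with connected support\<close>

definition abs_dev :: "real measure \<Rightarrow> real \<Rightarrow> real" where
  "abs_dev \<nu> x = (\<integral>y. \<bar>x - y\<bar> \<partial>\<nu>)"

text \<open>The properties of a marginal of \<open>\<mu>\<close>, with \<open>C\<close> the projection of \<open>K\<close>.\<close>

locale connected_support = real_distribution \<nu> for \<nu> :: "real measure" +
  fixes C :: "real set"
  assumes compact: "compact C" and connected: "connected C"
    and AE_in: "AE y in \<nu>. y \<in> C"
    and ball_pos: "\<And>c \<epsilon>. c \<in> C \<Longrightarrow> \<epsilon> > 0 \<Longrightarrow> measure \<nu> (ball c \<epsilon>) > 0"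
    and no_atoms: "\<And>x. measure \<nu> {x} = 0"
begin

text \<open>Let \<open>G = cdf \<nu>\<close>. Since \<open>G u < 1\<close> and \<open>G v > 0\<close>, the set \<open>C\<close> contains a point right of \<open>u\<close> and, as there
  is no atom at \<open>v\<close>, a point left of \<open>v\<close>. Being connected, it meets the open
  interval between \<open>u\<close> and \<open>v\<close>, and a ball around a common point has positive mass.\<close>

lemma cdf_strict:
  assumes "u < v" "cdf \<nu> u < 1" "cdf \<nu> v > 0"
  shows "cdf \<nu> u < cdf \<nu> v"
proof -
  obtain c2 where c2: "c2 \<in> C" "c2 > u"
  proof (rule ccontr)
    assume no: "\<not> thesis"
    have "AE y in \<nu>. y \<in> {..u}"
      using AE_in by eventually_elim (use that no not_less in \<open>auto\<close>)
    then have "measure \<nu> {..u} = 1"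
      by (subst prob_eq_1) auto
    then show False using assms(2) by (simp add: cdf_def)
  qed
  obtain c1 where c1: "c1 \<in> C" "c1 < v"
  proof (rule ccontr)
    assume no: "\<not> thesis"
    have "AE y in \<nu>. y \<notin> {..<v}"
      using AE_in by eventually_elim (use that no in \<open>auto\<close>)
    then have "measure \<nu> {..<v} = 0"
      by (subst prob_eq_0) auto
    moreover have "{..v} = {..<v} \<union> {v}" by auto
    then have "measure \<nu> {..v} = measure \<nu> {..<v} + measure \<nu> {v}"
      using finite_measure_Union[of "{..<v}" "{v}"] by simp
    ultimately show False using assms(3) no_atoms[of v] by (simp add: cdf_def)
  qed
  obtain c where c: "c \<in> C" "u < c" "c < v"
  proof -
    consider "c1 > u" | "c2 < v" | "c1 \<le> u" "v \<le> c2" by linarith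
    then show ?thesis
    proof cases
      case 3
      then have "(u + v) / 2 \<in> C"
        using connectedD_interval[OF connected c1(1) c2(1), of "(u + v) / 2"] assms(1) by auto
      then show ?thesis using that[of "(u + v) / 2"] assms(1) by simp
    qed (use that c1 c2 in auto)
  qed
  have "ball c (min (c - u) (v - c)) \<subseteq> {u<..v}"
    by (auto simp: dist_real_def)
  then have "measure \<nu> (ball c (min (c - u) (v - c))) \<le> measure \<nu> {u<..v}"
    by (intro finite_measure_mono) auto
  then show ?thesis
    using ball_pos[of c "min (c - u) (v - c)"] c cdf_diff_eq[of u v] assms(1) by simp
qed

text \<open>Without atoms \<open>cdf \<nu>\<close> is continuous, so the intermediate value theorem gives \<open>m\<close>; strict
  monotonicity at the level 1/2 gives the rest.\<close>

lemma median_exists: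
  obtains m where "cdf \<nu> m = 1/2" "\<And>x. x < m \<Longrightarrow> cdf \<nu> x < 1/2" "\<And>x. x > m \<Longrightarrow> cdf \<nu> x > 1/2"
proof -
  have "eventually (\<lambda>x. cdf \<nu> x < 1/2) at_bot"
    by (rule order_tendstoD(2)[OF cdf_lim_at_bot]) simp
  then obtain u where u: "\<And>x. x \<le> u \<Longrightarrow> cdf \<nu> x < 1/2"
    by (auto simp: eventually_at_bot_linorder)
  have "eventually (\<lambda>x. cdf \<nu> x > 1/2) at_top"
    by (rule order_tendstoD(1)[OF cdf_lim_at_top_prob]) simp
  then obtain v where v: "\<And>x. x \<ge> v \<Longrightarrow> cdf \<nu> x > 1/2"
    by (auto simp: eventually_at_top_linorder)
  have "u \<le> v"
    using u[of v] v[of v] by force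
  moreover have "continuous_on {u..v} (cdf \<nu>)"
    by (intro continuous_at_imp_continuous_on ballI) (simp add: isCont_cdf no_atoms)
  ultimately obtain m where m: "cdf \<nu> m = 1/2"
    using IVT'[of "cdf \<nu>" u "1/2" v] u[of u] v[of v] by auto
  show ?thesis
  proof (rule that[OF m])
    show "cdf \<nu> x < 1/2" if "x < m" for x
      using cdf_strict[OF that] cdf_nondecreasing[of x m] that m by simp
    show "cdf \<nu> x > 1/2" if "x > m" for x
      using cdf_strict[OF that] cdf_nondecreasing[of m x] that m by simp
  qed
qed

lemma abs_dev_integrable: "integrable \<nu> (\<lambda>y. \<bar>x - y\<bar>)"
proof -
  obtain B where B: "\<And>y. y \<in> C \<Longrightarrow> \<bar>y\<bar> \<le> B"
    using compact_imp_bounded[OF compact] by (auto simp: bounded_iff)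
  show ?thesis
  proof (rule integrable_const_bound[where B="\<bar>x\<bar> + B"])
    show "AE y in \<nu>. norm \<bar>x - y\<bar> \<le> \<bar>x\<bar> + B"
      using AE_in
    proof eventually_elim
      case (elim y)
      then show ?case using B[of y] abs_triangle_ineq4[of x y] by simp
    qed
  qed simp
qed

text \<open>The integral of the pointwise inequality \<open>\<bar>y - z\<bar> + (x - y) * step_sign y z \<le> \<bar>x - z\<bar>\<close>:
  \<open>step_sign y z\<close> is a subgradient of \<open>\<lambda>y. \<bar>y - z\<bar>\<close>, also for the value 1 at \<open>y = z\<close>.\<close>

lemma abs_dev_subgradient: "abs_dev \<nu> y + (x - y) * (2 * cdf \<nu> y - 1) \<le> abs_dev \<nu> x"
proof -
  have s: "integrable \<nu> (\<lambda>z. (x - y) * step_sign y z)"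
    by (intro integrable_mult_right integrable_const_bound[where B=1]) auto
  have "(\<integral>z. \<bar>y - z\<bar> + (x - y) * step_sign y z \<partial>\<nu>) \<le> abs_dev \<nu> x"
    unfolding abs_dev_def
    by (intro integral_mono Bochner_Integration.integrable_add abs_dev_integrable s)
      (auto simp: step_sign_def)
  also have "(\<integral>z. \<bar>y - z\<bar> + (x - y) * step_sign y z \<partial>\<nu>)
      = abs_dev \<nu> y + (x - y) * (2 * cdf \<nu> y - 1)"
    by (subst Bochner_Integration.integral_add[OF abs_dev_integrable s])
      (simp add: abs_dev_def integral_step_sign prob_space_axioms)
  finally show ?thesis .
qed

text \<open>The subgradients lie between -1 and 1.\<close>

lemma abs_dev_lipschitz: "\<bar>abs_dev \<nu> x - abs_dev \<nu> y\<bar> \<le> \<bar>x - y\<bar>"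
proof -
  have "abs_dev \<nu> y - abs_dev \<nu> x \<le> \<bar>x - y\<bar>" for x y
  proof -
    have "abs_dev \<nu> y - abs_dev \<nu> x \<le> \<bar>(x - y) * (2 * cdf \<nu> y - 1)\<bar>"
      using abs_dev_subgradient[of y x] by linarith
    also have "\<dots> \<le> \<bar>x - y\<bar>"
      using cdf_bounded_prob[of y] cdf_nonneg[of y]
      unfolding abs_mult by (intro mult_left_le) auto
    finally show ?thesis .
  qed
  from this[of x y] this[of y x] show ?thesis by linarith
qed

lemma continuous_abs_dev: "continuous_on A (abs_dev \<nu>)"
proof -
  have "1-lipschitz_on A (abs_dev \<nu>)"
    using abs_dev_lipschitz by (intro lipschitz_onI) (auto simp: dist_real_def)
  then show ?thesis by (rule lipschitz_on_continuous_on)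
qed

text \<open>At \<open>m\<close> the subgradient is 0, so \<open>m\<close> is a minimizer. Strictness comes from the midpoint of
  \<open>m\<close> and \<open>x\<close>, where the subgradient is nonzero and points towards \<open>x\<close>.\<close>

lemma abs_dev_median_less:
  assumes "cdf \<nu> m = 1/2" "\<And>x. x < m \<Longrightarrow> cdf \<nu> x < 1/2" "\<And>x. x > m \<Longrightarrow> cdf \<nu> x > 1/2" "x \<noteq> m"
  shows "abs_dev \<nu> m < abs_dev \<nu> x"
proof -
  define y where "y = (x + m) / 2"
  have "(x - y) * (2 * cdf \<nu> y - 1) > 0"
  proof (cases "x < m")
    case True
    then have "x < y" "y < m" by (auto simp: y_def)
    then show ?thesis using assms(2)[of y] by (intro mult_neg_neg) auto
  next
    case False
    then have "y < x" "m < y" using assms(4) by (auto simp: y_def)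
    then show ?thesis using assms(3)[of y] by (intro mult_pos_pos) auto
  qed
  then show ?thesis
    using abs_dev_subgradient[of y x] abs_dev_subgradient[of m y] assms(1) by simp
qed

end

section \<open>From the coordinates to the plane\<close>

text \<open>For \<open>\<pi>\<close> one of the two coordinate projections. Being 1-Lipschitz, \<open>\<pi>\<close> maps each ball
  around \<open>q\<close> into the ball of the same radius around \<open>\<pi> q\<close>, which therefore inherits its
  mass.\<close>

lemma marginal_connected_support:
  fixes K :: "(real \<times> real) set" and \<pi> :: "real \<times> real \<Rightarrow> real"
  assumes K: "compact K" "connected K" and \<mu>: "prob_space \<mu>" "sets \<mu> = sets (restrict_space borel K)"
    and pos: "\<And>p \<epsilon>. p \<in> K \<Longrightarrow> \<epsilon> > 0 \<Longrightarrow> measure \<mu> (ball p \<epsilon> \<inter> K) > 0"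
    and no_atoms: "\<And>x. measure \<mu> {p \<in> K. \<pi> p = x} = 0"
    and \<pi>: "1-lipschitz_on UNIV \<pi>"
  shows "connected_support (distr \<mu> borel \<pi>) (\<pi> ` K)"
proof -
  interpret \<mu>: prob_space \<mu> by fact
  have cont: "continuous_on A \<pi>" for A
    using lipschitz_on_continuous_on[OF \<pi>] by (rule continuous_on_subset) simp
  have [measurable]: "\<pi> \<in> borel_measurable \<mu>"
    using borel_measurable_continuous_onI[OF cont]
    by (subst measurable_cong_sets[OF \<mu>(2) refl]) (rule measurable_restrict_space1)
  have space: "space \<mu> = K"
    using sets_eq_imp_space_eq[OF \<mu>(2)] by (simp add: space_restrict_space)
  interpret real_distribution "distr \<mu> borel \<pi>"
    by (auto simp: real_distribution_def real_distribution_axioms_def intro!: \<mu>.prob_space_distr)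
  show ?thesis
  proof
    show "compact (\<pi> ` K)" "connected (\<pi> ` K)"
      using K cont by (auto intro: compact_continuous_image connected_continuous_image)
    then have "\<pi> ` K \<in> sets borel" by (auto intro: borel_compact)
    then show "AE y in distr \<mu> borel \<pi>. y \<in> \<pi> ` K"
      by (subst AE_distr_iff) (auto simp: space[symmetric])
    show "measure (distr \<mu> borel \<pi>) {x} = 0" for x
      using no_atoms[of x] by (subst measure_distr) (auto simp: space vimage_def Int_def conj_commute)
    fix c \<epsilon> :: real assume "c \<in> \<pi> ` K" "\<epsilon> > 0"
    then obtain q where q: "q \<in> K" "c = \<pi> q" by blast
    have "ball q \<epsilon> \<inter> K \<subseteq> \<pi> -` ball c \<epsilon> \<inter> space \<mu>"
    proof
      fix y assume "y \<in> ball q \<epsilon> \<inter> K"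
      moreover have "dist (\<pi> q) (\<pi> y) \<le> dist q y"
        using lipschitz_onD[OF \<pi>, of q y] by simp
      ultimately show "y \<in> \<pi> -` ball c \<epsilon> \<inter> space \<mu>"
        by (simp add: q space)
    qed
    then have "measure \<mu> (ball q \<epsilon> \<inter> K) \<le> measure \<mu> (\<pi> -` ball c \<epsilon> \<inter> space \<mu>)"
      by (intro \<mu>.finite_measure_mono) auto
    then show "measure (distr \<mu> borel \<pi>) (ball c \<epsilon>) > 0"
      using pos[OF q(1) \<open>\<epsilon> > 0\<close>] by (subst measure_distr) auto
  qed
qed

lemma generalized_conic_eq:
  assumes \<mu>: "sets \<mu> = sets (restrict_space borel K)"
    and "connected_support (distr \<mu> borel fst) C" "connected_support (distr \<mu> borel snd) D"
  shows "generalized_conic K \<mu> z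
    = abs_dev (distr \<mu> borel fst) (fst z) + abs_dev (distr \<mu> borel snd) (snd z)"
proof -
  interpret X: connected_support "distr \<mu> borel fst" C by fact
  interpret Y: connected_support "distr \<mu> borel snd" D by fact
  have \<pi>: "fst \<in> borel_measurable \<mu>" "snd \<in> borel_measurable \<mu>"
    by (subst measurable_cong_sets[OF \<mu> refl], rule measurable_restrict_space1,
        intro borel_measurable_continuous_onI continuous_intros)+
  note [measurable] = \<pi>
  have space: "space \<mu> = K"
    using sets_eq_imp_space_eq[OF \<mu>] by (simp add: space_restrict_space)
  have i: "integrable \<mu> (\<lambda>p. \<bar>fst z - fst p\<bar>)" "integrable \<mu> (\<lambda>p. \<bar>snd z - snd p\<bar>)"
    using X.abs_dev_integrable[of "fst z"] Y.abs_dev_integrable[of "snd z"]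
    by (auto simp: integrable_distr_eq)
  have "generalized_conic K \<mu> z = (\<integral>p. \<bar>fst z - fst p\<bar> + \<bar>snd z - snd p\<bar> \<partial>\<mu>)"
    unfolding generalized_conic_def set_lebesgue_integral_def
    by (intro Bochner_Integration.integral_cong) (auto simp: space)
  also have "\<dots> = abs_dev (distr \<mu> borel fst) (fst z) + abs_dev (distr \<mu> borel snd) (snd z)"
    by (subst Bochner_Integration.integral_add[OF i]) (simp add: abs_dev_def integral_distr)
  finally show ?thesis .
qed

lemma (in prob_space) converges_in_Lq_const:
  fixes Y :: "nat \<Rightarrow> 'a \<Rightarrow> real"
  assumes Y [measurable]: "\<And>k. Y k \<in> borel_measurable M"
    and bound: "\<And>k. AE \<omega> in M. \<bar>Y k \<omega> - z\<bar> \<le> R"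
    and lim: "AE \<omega> in M. (\<lambda>k. Y k \<omega>) \<longlonglongrightarrow> z" and q: "q \<ge> 1"
  shows "converges_in_Lq M q Y (\<lambda>_. z)"
proof -
  have "integrable M (\<lambda>\<omega>. \<bar>Y k \<omega>\<bar> ^ q)" for k
  proof (rule integrable_const_bound[where B="(\<bar>z\<bar> + R) ^ q"])
    show "AE \<omega> in M. norm (\<bar>Y k \<omega>\<bar> ^ q) \<le> (\<bar>z\<bar> + R) ^ q"
      using bound[of k]
    proof eventually_elim
      case (elim \<omega>)
      then have "\<bar>Y k \<omega>\<bar> \<le> \<bar>z\<bar> + R" by linarith
      then show ?case by (simp add: power_mono)
    qed
  qed simp
  moreover have "(\<lambda>k. \<integral>\<omega>. \<bar>Y k \<omega> - z\<bar> ^ q \<partial>M) \<longlonglongrightarrow> (\<integral>\<omega>. 0 \<partial>M)"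
  proof (rule integral_dominated_convergence[where w="\<lambda>_. R ^ q"])
    show "AE \<omega> in M. (\<lambda>k. \<bar>Y k \<omega> - z\<bar> ^ q) \<longlonglongrightarrow> 0"
      using lim
    proof eventually_elim
      case (elim \<omega>)
      then have "(\<lambda>k. \<bar>Y k \<omega> - z\<bar> ^ q) \<longlonglongrightarrow> \<bar>z - z\<bar> ^ q"
        by (intro tendsto_intros)
      then show ?case using q by (simp add: power_0_left)
    qed
    show "AE \<omega> in M. norm (\<bar>Y k \<omega> - z\<bar> ^ q) \<le> R ^ q" for k
      using bound[of k] by eventually_elim (simp add: power_mono)
  qed auto
  ultimately show ?thesis
    by (auto simp: converges_in_Lq_def)
qed

theorem theorem3p3:
  fixes K :: "(real \<times> real) set" and \<mu> :: "(real \<times> real) measure"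
    and t :: "nat \<Rightarrow> real" and x0 :: "real \<times> real"
    and M :: "'w measure" and P :: "nat \<Rightarrow> 'w \<Rightarrow> real \<times> real"
  assumes "compact_body K" and "connected K"
    and "prob_space \<mu>" and "sets \<mu> = sets (restrict_space borel K)"
    and "\<And>p \<epsilon>. p \<in> K \<Longrightarrow> \<epsilon> > 0 \<Longrightarrow> measure \<mu> (ball p \<epsilon> \<inter> K) > 0"
    and "\<And>x. measure \<mu> {p \<in> K. fst p = x} = 0"
    and "\<And>y. measure \<mu> {p \<in> K. snd p = y} = 0"
    and "\<And>k. k \<ge> 1 \<Longrightarrow> t k > 0"
    and "\<And>k. k \<ge> 1 \<Longrightarrow> t (Suc k) \<le> t k"
    and "filterlim (\<lambda>n. \<Sum>k=1..n. t k) at_top sequentially"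
    and "summable (\<lambda>k. (t (Suc k))\<^sup>2)"
    and "x0 \<in> K"
    and "prob_space M"
    and "prob_space.indep_vars M (\<lambda>_. borel) P {1..}"
    and "\<And>k. k \<ge> 1 \<Longrightarrow> distr M borel (P k) = distr \<mu> borel (\<lambda>p. p)"
  shows "(\<exists>!z. is_arg_min (generalized_conic K \<mu>) (\<lambda>_. True) z) \<and>
    (\<forall>z. is_arg_min (generalized_conic K \<mu>) (\<lambda>_. True) z \<longrightarrow>
      (AE \<omega> in M. (\<lambda>k. generalized_conic K \<mu> (stoch_iter t P x0 k \<omega>))
                     \<longlonglongrightarrow> generalized_conic K \<mu> z) \<and>
      (\<forall>q\<ge>1. converges_in_Lq M q (\<lambda>k \<omega>. generalized_conic K \<mu> (stoch_iter t P x0 k \<omega>))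
                     (\<lambda>_. generalized_conic K \<mu> z)))"
proof -
  interpret prob_space M by fact
  have K: "compact K" using assms(1) by (simp add: compact_body_def)
  let ?\<nu> = "\<lambda>\<pi>. distr \<mu> borel (\<pi> :: real \<times> real \<Rightarrow> real)"
  \<comment> \<open>stated for an arbitrary projection \<open>\<pi>\<close>, to be used for both coordinates\<close>
  have coordinate: "\<exists>m r. connected_support (?\<nu> \<pi>) (\<pi> ` K) \<and>
      (\<forall>x. x \<noteq> m \<longrightarrow> abs_dev (?\<nu> \<pi>) m < abs_dev (?\<nu> \<pi>) x) \<and>
      (AE \<omega> in M. (\<lambda>k. sign_iter t (\<lambda>i \<omega>. \<pi> (P i \<omega>)) (\<pi> x0) k \<omega>) \<longlonglongrightarrow> m) \<and>
      (AE \<omega> in M. \<forall>k. \<bar>sign_iter t (\<lambda>i \<omega>. \<pi> (P i \<omega>)) (\<pi> x0) k \<omega> - m\<bar> \<le> r) \<and>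
      (\<forall>k. sign_iter t (\<lambda>i \<omega>. \<pi> (P i \<omega>)) (\<pi> x0) k \<in> borel_measurable M)"
    if no_atoms: "\<And>x. measure \<mu> {p \<in> K. \<pi> p = x} = 0" and \<pi>: "1-lipschitz_on UNIV \<pi>" for \<pi>
  proof -
    interpret C: connected_support "?\<nu> \<pi>" "\<pi> ` K"
      by (rule marginal_connected_support) (use assms K no_atoms \<pi> in auto)
    obtain m where m: "cdf (?\<nu> \<pi>) m = 1/2" "\<And>x. x < m \<Longrightarrow> cdf (?\<nu> \<pi>) x < 1/2"
        "\<And>x. x > m \<Longrightarrow> cdf (?\<nu> \<pi>) x > 1/2"
      using C.median_exists by blast
    have \<pi>_borel [measurable]: "\<pi> \<in> borel_measurable borel"
      by (rule borel_measurable_continuous_onI[OF lipschitz_on_continuous_on[OF \<pi>]])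
    have id: "(\<lambda>p. p) \<in> measurable \<mu> borel"
      by (subst measurable_cong_sets[OF assms(4) refl]) (rule measurable_restrict_space1, simp)
    obtain a b where ab: "\<And>y. y \<in> \<pi> ` K \<Longrightarrow> y \<in> {a..b}"
    proof -
      obtain B where "\<And>y. y \<in> \<pi> ` K \<Longrightarrow> \<bar>y\<bar> \<le> B"
        using compact_imp_bounded[OF C.compact] by (auto simp: bounded_iff)
      then show ?thesis using that[of "-B" B] by (force simp: abs_le_iff)
    qed
    interpret R: median_recursion M "?\<nu> \<pi>" t "\<lambda>i \<omega>. \<pi> (P i \<omega>)" "\<pi> x0" m a b
    proof
      show "indep_vars (\<lambda>_. borel) (\<lambda>i \<omega>. \<pi> (P i \<omega>)) {1..}"
        by (rule indep_vars_compose2[OF assms(14)]) simp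
      show "distr M borel (\<lambda>\<omega>. \<pi> (P k \<omega>)) = ?\<nu> \<pi>" if k: "k \<ge> 1" for k
      proof -
        have P: "P k \<in> measurable M borel"
          using assms(14) k by (auto simp: indep_vars_def)
        have "distr M borel (\<lambda>\<omega>. \<pi> (P k \<omega>)) = distr (distr M borel (P k)) borel \<pi>"
          using P by (simp add: distr_distr comp_def)
        also have "\<dots> = ?\<nu> \<pi>"
          using id by (simp add: assms(15)[OF k] distr_distr comp_def)
        finally show ?thesis .
      qed
      show "AE y in ?\<nu> \<pi>. y \<in> {a..b}"
        using C.AE_in ab by (auto elim!: eventually_mono)
      show "\<pi> x0 \<in> {a..b}" using ab assms(12) by blast
    qed (use m assms in auto)
    show ?thesis
      using C.connected_support_axioms C.abs_dev_median_less[OF m] R.AE_tendsto_median R.x_bounded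
        R.x_measurable by blast
  qed
  have fst_lip: "1-lipschitz_on UNIV (fst :: real \<times> real \<Rightarrow> real)"
    by (rule lipschitz_onI) (simp_all add: dist_fst_le)
  have snd_lip: "1-lipschitz_on UNIV (snd :: real \<times> real \<Rightarrow> real)"
    by (rule lipschitz_onI) (simp_all add: dist_snd_le)
  obtain m1 r1 where 1: "connected_support (?\<nu> fst) (fst ` K)"
      "\<And>x. x \<noteq> m1 \<Longrightarrow> abs_dev (?\<nu> fst) m1 < abs_dev (?\<nu> fst) x"
      "AE \<omega> in M. (\<lambda>k. fst (stoch_iter t P x0 k \<omega>)) \<longlonglongrightarrow> m1"
      "AE \<omega> in M. \<forall>k. \<bar>fst (stoch_iter t P x0 k \<omega>) - m1\<bar> \<le> r1"
      "\<And>k. (\<lambda>\<omega>. fst (stoch_iter t P x0 k \<omega>)) \<in> borel_measurable M"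
    using coordinate[OF assms(6) fst_lip] unfolding fst_stoch_iter by blast
  obtain m2 r2 where 2: "connected_support (?\<nu> snd) (snd ` K)"
      "\<And>x. x \<noteq> m2 \<Longrightarrow> abs_dev (?\<nu> snd) m2 < abs_dev (?\<nu> snd) x"
      "AE \<omega> in M. (\<lambda>k. snd (stoch_iter t P x0 k \<omega>)) \<longlonglongrightarrow> m2"
      "AE \<omega> in M. \<forall>k. \<bar>snd (stoch_iter t P x0 k \<omega>) - m2\<bar> \<le> r2"
      "\<And>k. (\<lambda>\<omega>. snd (stoch_iter t P x0 k \<omega>)) \<in> borel_measurable M"
    using coordinate[OF assms(7) snd_lip] unfolding snd_stoch_iter by blast
  note [measurable] = 1(5) 2(5)
  interpret X: connected_support "?\<nu> fst" "fst ` K" by (rule 1(1))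
  interpret Y: connected_support "?\<nu> snd" "snd ` K" by (rule 2(1))
  note F = generalized_conic_eq[OF assms(4) 1(1) 2(1)]
  have less: "generalized_conic K \<mu> (m1, m2) < generalized_conic K \<mu> z" if "z \<noteq> (m1, m2)" for z
  proof (cases "fst z = m1")
    case True
    then have "snd z \<noteq> m2" using that by (auto simp: prod_eq_iff)
    then show ?thesis using True 2(2) by (simp add: F)
  next
    case False
    then have "abs_dev (?\<nu> snd) m2 \<le> abs_dev (?\<nu> snd) (snd z)"
      using 2(2)[of "snd z"] by (cases "snd z = m2") auto
    then show ?thesis using False 1(2)[of "fst z"] by (simp add: F)
  qed
  then have min: "is_arg_min (generalized_conic K \<mu>) (\<lambda>_. True) z \<longleftrightarrow> z = (m1, m2)" for z
    unfolding is_arg_min_def by (metis less_asym less_irrefl)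
  let ?Y = "\<lambda>k \<omega>. generalized_conic K \<mu> (stoch_iter t P x0 k \<omega>)"
  have [measurable]: "abs_dev (?\<nu> fst) \<in> borel_measurable borel" "abs_dev (?\<nu> snd) \<in> borel_measurable borel"
    by (intro borel_measurable_continuous_onI X.continuous_abs_dev Y.continuous_abs_dev)+
  have meas: "?Y k \<in> borel_measurable M" for k
    unfolding F by measurable
  have lim: "AE \<omega> in M. (\<lambda>k. ?Y k \<omega>) \<longlonglongrightarrow> generalized_conic K \<mu> (m1, m2)"
    using 1(3) 2(3)
  proof eventually_elim
    case (elim \<omega>)
    then show ?case
      unfolding F fst_conv snd_conv
      by (intro tendsto_add continuous_on_tendsto_compose[OF X.continuous_abs_dev[of UNIV]]
          continuous_on_tendsto_compose[OF Y.continuous_abs_dev[of UNIV]]) auto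
  qed
  have bound: "AE \<omega> in M. \<bar>?Y k \<omega> - generalized_conic K \<mu> (m1, m2)\<bar> \<le> r1 + r2" for k
    using 1(4) 2(4)
  proof eventually_elim
    case (elim \<omega>)
    have "\<bar>fst (stoch_iter t P x0 k \<omega>) - m1\<bar> \<le> r1" "\<bar>snd (stoch_iter t P x0 k \<omega>) - m2\<bar> \<le> r2"
      using elim by auto
    then show ?case
      using X.abs_dev_lipschitz[of "fst (stoch_iter t P x0 k \<omega>)" m1]
        Y.abs_dev_lipschitz[of "snd (stoch_iter t P x0 k \<omega>)" m2]
      unfolding F fst_conv snd_conv by linarith
  qed
  show ?thesis
    unfolding min using lim converges_in_Lq_const[OF meas bound lim] by auto
qed

end
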